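(* Let $A$ be a $k$-element set $(k\geq 4)$. If $\rho$ is an $r$-ary central relation on $A$ such that $2\leq r\leq k-2$, then $\mathrm{Pol}\,\rho\notin\mathfrak{F}_A$.
   Context: For $n\ge 1$, an $n$-ary operation on $A$ is a function $A^n\to A$; $\mathcal{O}_A$ is the set of all finitary operations on $A$, and $\mathcal{C}^{(n)}$ is the set of $n$-ary members of $\mathcal{C}\subseteq\mathcal{O}_A$. A clone on $A$ is a set $\mathcal{C}\subseteq\mathcal{O}_A$ containing all projections and closed under composition. For a clone $\mathcal{C}$, an $n$-ary $f$ and an $m$-ary $g$ in $\mathcal{O}_A$, write $f\leq_{\mathcal{C}} g$ if $f=g(h_1,\dots,h_m)$ for some $h_1,\dots,h_m\in\mathcal{C}^{(n)}$, and $f\equiv_{\mathcal{C}}g$ if $f\leq_{\mathcal{C}}g$ and $g\leq_{\mathcal{C}}f$. $\mathfrak{F}_A$ denotes the set of all clones $\mathcal{C}$ on $A$ such that the equivalence relation $\equiv_{\mathcal{C}}$ on $\mathcal{O}_A$ has only finitely many classes. An $r$-ary relation $\rho$ on $A$ is totally reflexive if it contains every $r$-tuple in $A^r$ whose coordinates are not pairwise distinct, and totally symmetric if it is invariant under every permutation of its coordinates. $\rho$ is a central relation if $\emptyset\neq\rho\neq A^r$, $\rho$ is totally reflexive and totally symmetric, and there exists $c\in A$ with $\{c\}\times A^{r-1}\subseteq\rho$. $\mathrm{Pol}\,\rho$ is the clone of all operations on $A$ which applied coordinatewise to tuples of $\rho$ give tuples of $\rho$. *)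

theory Defs
  imports "HOL-Library.FuncSet" "HOL-Combinatorics.Permutations"
begin

definition tuples :: "'a set \<Rightarrow> nat \<Rightarrow> 'a list set" where
  "tuples A n = {xs. length xs = n \<and> set xs \<subseteq> A}"

text \<open>
  A finitary operation is a pair of its arity and a function on lists that is
  \<^const>\<open>undefined\<close> off \<open>tuples A n\<close>, so that HOL equality of operations is
  equality of operations on \<open>A\<close>. The arity is at least 1.
\<close>

type_synonym 'a oper = "nat \<times> ('a list \<Rightarrow> 'a)"

definition opers :: "'a set \<Rightarrow> 'a oper set" where
  "opers A = (SIGMA n:{1..}. tuples A n \<rightarrow>\<^sub>E A)"

definition n_ary :: "'a oper set \<Rightarrow> nat \<Rightarrow> ('a list \<Rightarrow> 'a) set" where
  "n_ary C n = {f. (n, f) \<in> C}"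

text \<open>Coordinates are indexed from 0.\<close>

definition projection :: "'a set \<Rightarrow> nat \<Rightarrow> nat \<Rightarrow> 'a list \<Rightarrow> 'a" where
  "projection A n i = (\<lambda>xs\<in>tuples A n. xs ! i)"

text \<open>
  \<open>compose_op A n g [h\<^sub>1, \<dots>, h\<^sub>m]\<close> is \<open>g(h\<^sub>1, \<dots>, h\<^sub>m)\<close>, where \<open>g\<close> is \<open>m\<close>-ary and
  all \<open>h\<^sub>i\<close> are \<open>n\<close>-ary.
\<close>

definition compose_op ::
    "'a set \<Rightarrow> nat \<Rightarrow> ('a list \<Rightarrow> 'a) \<Rightarrow> ('a list \<Rightarrow> 'a) list \<Rightarrow> 'a list \<Rightarrow> 'a" where
  "compose_op A n g hs = (\<lambda>xs\<in>tuples A n. g (map (\<lambda>h. h xs) hs))"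

definition clone :: "'a set \<Rightarrow> 'a oper set \<Rightarrow> bool" where
  "clone A C \<longleftrightarrow> C \<subseteq> opers A
     \<and> (\<forall>n\<ge>1. \<forall>i<n. projection A n i \<in> n_ary C n)
     \<and> (\<forall>n\<ge>1. \<forall>m\<ge>1. \<forall>g\<in>n_ary C m. \<forall>hs. length hs = m \<and> set hs \<subseteq> n_ary C n
           \<longrightarrow> compose_op A n g hs \<in> n_ary C n)"

definition clone_le :: "'a set \<Rightarrow> 'a oper set \<Rightarrow> 'a oper \<Rightarrow> 'a oper \<Rightarrow> bool" where
  "clone_le A C = (\<lambda>(n, f) (m, g).
     \<exists>hs. length hs = m \<and> set hs \<subseteq> n_ary C n \<and> f = compose_op A n g hs)"

definition clone_equiv :: "'a set \<Rightarrow> 'a oper set \<Rightarrow> 'a oper rel" where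
  "clone_equiv A C =
     {(f, g). f \<in> opers A \<and> g \<in> opers A \<and> clone_le A C f g \<and> clone_le A C g f}"

definition finite_class_clones :: "'a set \<Rightarrow> 'a oper set set" where
  "finite_class_clones A = {C. clone A C \<and> finite (opers A // clone_equiv A C)}"

definition totally_reflexive :: "'a set \<Rightarrow> nat \<Rightarrow> 'a list set \<Rightarrow> bool" where
  "totally_reflexive A r \<rho> \<longleftrightarrow> (\<forall>xs\<in>tuples A r. \<not> distinct xs \<longrightarrow> xs \<in> \<rho>)"

definition totally_symmetric :: "nat \<Rightarrow> 'a list set \<Rightarrow> bool" where
  "totally_symmetric r \<rho> \<longleftrightarrow>
     (\<forall>p. p permutes {..<r} \<longrightarrow> (\<forall>xs\<in>\<rho>. permute_list p xs \<in> \<rho>))"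

definition central_relation :: "'a set \<Rightarrow> nat \<Rightarrow> 'a list set \<Rightarrow> bool" where
  "central_relation A r \<rho> \<longleftrightarrow> r \<ge> 1 \<and> \<rho> \<subseteq> tuples A r \<and> \<rho> \<noteq> {} \<and> \<rho> \<noteq> tuples A r
     \<and> totally_reflexive A r \<rho> \<and> totally_symmetric r \<rho>
     \<and> (\<exists>c\<in>A. \<forall>xs\<in>tuples A (r - 1). c # xs \<in> \<rho>)"

text \<open>
  \<open>ts\<close> lists the \<open>n\<close> tuples of \<open>\<rho>\<close> to which an \<open>n\<close>-ary \<open>f\<close> is applied coordinatewise.
\<close>

definition Pol :: "'a set \<Rightarrow> nat \<Rightarrow> 'a list set \<Rightarrow> 'a oper set" where
  "Pol A r \<rho> = {(n, f) \<in> opers A. \<forall>ts. length ts = n \<and> set ts \<subseteq> \<rho>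
     \<longrightarrow> map (\<lambda>i. f (map (\<lambda>t. t ! i) ts)) [0..<r] \<in> \<rho>}"

lemma projection_in_opers:
  assumes "i < n"
  shows "(n, projection A n i) \<in> opers A"
  using assms by (auto simp: opers_def projection_def tuples_def)

lemma compose_op_in_opers:
  assumes "(m, g) \<in> opers A" "n \<ge> 1" "length hs = m" "\<And>h. h \<in> set hs \<Longrightarrow> (n, h) \<in> opers A"
  shows "(n, compose_op A n g hs) \<in> opers A"
proof -
  have "map (\<lambda>h. h xs) hs \<in> tuples A m" if "xs \<in> tuples A n" for xs
    using assms(3,4) that by (fastforce simp: tuples_def opers_def)
  then show ?thesis
    using assms(1,2) by (auto simp: opers_def compose_op_def)
qed

lemma compose_op_projections:
  assumes "(n, f) \<in> opers A"
  shows "compose_op A n f (map (projection A n) [0..<n]) = f"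
proof
  fix xs
  show "compose_op A n f (map (projection A n) [0..<n]) xs = f xs"
  proof (cases "xs \<in> tuples A n")
    case True
    then have "map (\<lambda>h. h xs) (map (projection A n) [0..<n]) = xs"
      by (auto simp: projection_def tuples_def intro!: nth_equalityI)
    with True show ?thesis by (simp add: compose_op_def)
  next
    case False
    with assms show ?thesis by (auto simp: compose_op_def opers_def PiE_def extensional_def)
  qed
qed

lemma compose_op_assoc:
  assumes "\<And>h. h \<in> set hs \<Longrightarrow> (n, h) \<in> opers A"
    and "length hs = m"
  shows "compose_op A n (compose_op A m g us) hs
       = compose_op A n g (map (\<lambda>u. compose_op A n u hs) us)"
proof
  fix xs
  have "map (\<lambda>h. h xs) hs \<in> tuples A m" if "xs \<in> tuples A n"
    using assms that by (fastforce simp: tuples_def opers_def)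
  then show "compose_op A n (compose_op A m g us) hs xs
       = compose_op A n g (map (\<lambda>u. compose_op A n u hs) us) xs"
    by (auto simp: compose_op_def comp_def)
qed

lemma clone_Pol:
  assumes "\<rho> \<subseteq> tuples A r"
  shows "clone A (Pol A r \<rho>)"
  unfolding clone_def
proof (intro conjI allI impI ballI)
  show "Pol A r \<rho> \<subseteq> opers A" by (auto simp: Pol_def)
next
  fix n i :: nat assume "1 \<le> n" "i < n"
  have "map (\<lambda>j. projection A n i (map (\<lambda>t. t ! j) ts)) [0..<r] \<in> \<rho>"
    if ts: "length ts = n" "set ts \<subseteq> \<rho>" for ts
  proof -
    have ti: "ts ! i \<in> \<rho>" using ts \<open>i < n\<close> by auto
    have "map (\<lambda>t. t ! j) ts \<in> tuples A n" if "j < r" for j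
      using ts assms that by (fastforce simp: tuples_def)
    then have "map (\<lambda>j. projection A n i (map (\<lambda>t. t ! j) ts)) [0..<r] = ts ! i"
      using ti assms ts \<open>i < n\<close>
      by (auto simp: projection_def tuples_def intro!: nth_equalityI)
    with ti show ?thesis by simp
  qed
  then show "projection A n i \<in> n_ary (Pol A r \<rho>) n"
    using projection_in_opers[OF \<open>i < n\<close>] by (auto simp: Pol_def n_ary_def)
next
  fix n m :: nat and g hs
  assume n: "1 \<le> n" and g: "g \<in> n_ary (Pol A r \<rho>) m"
    and hs: "length hs = m \<and> set hs \<subseteq> n_ary (Pol A r \<rho>) n"
  have "map (\<lambda>j. compose_op A n g hs (map (\<lambda>t. t ! j) ts)) [0..<r] \<in> \<rho>"
    if ts: "length ts = n" "set ts \<subseteq> \<rho>" for ts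
  proof -
    let ?us = "map (\<lambda>h. map (\<lambda>i. h (map (\<lambda>t. t ! i) ts)) [0..<r]) hs"
    have "set ?us \<subseteq> \<rho>" "length ?us = m"
      using hs ts by (auto simp: n_ary_def Pol_def)
    then have "map (\<lambda>i. g (map (\<lambda>t. t ! i) ?us)) [0..<r] \<in> \<rho>"
      using g unfolding n_ary_def Pol_def by blast
    moreover have "map (\<lambda>t. t ! j) ts \<in> tuples A n" if "j < r" for j
      using ts assms that by (fastforce simp: tuples_def)
    then have "map (\<lambda>j. compose_op A n g hs (map (\<lambda>t. t ! j) ts)) [0..<r]
        = map (\<lambda>i. g (map (\<lambda>t. t ! i) ?us)) [0..<r]"
      by (auto simp: compose_op_def comp_def)
    ultimately show ?thesis by (simp only:)
  qed
  moreover have "(n, compose_op A n g hs) \<in> opers A"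
    using g hs n by (intro compose_op_in_opers[of m]) (auto simp: n_ary_def Pol_def)
  ultimately show "compose_op A n g hs \<in> n_ary (Pol A r \<rho>) n"
    by (auto simp: Pol_def n_ary_def)
qed

lemma clone_le_refl:
  assumes "clone A C" "f \<in> opers A"
  shows "clone_le A C f f"
proof -
  obtain n f' where f: "f = (n, f')" by (cases f)
  have "set (map (projection A n) [0..<n]) \<subseteq> n_ary C n"
    using assms f by (auto simp: clone_def opers_def)
  then show ?thesis
    using compose_op_projections[of n f' A] assms f
    by (auto simp: clone_le_def intro!: exI[of _ "map (projection A n) [0..<n]"])
qed

lemma clone_le_trans:
  assumes C: "clone A C" and f: "f \<in> opers A" and g: "g \<in> opers A"
    and fg: "clone_le A C f g" and gh: "clone_le A C g h"
  shows "clone_le A C f h"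
proof -
  obtain n f' m g' l h' where eq: "f = (n, f')" "g = (m, g')" "h = (l, h')"
    by (metis surj_pair)
  obtain us where us: "length us = m" "set us \<subseteq> n_ary C n" "f' = compose_op A n g' us"
    using fg eq by (auto simp: clone_le_def)
  obtain vs where vs: "length vs = l" "set vs \<subseteq> n_ary C m" "g' = compose_op A m h' vs"
    using gh eq by (auto simp: clone_le_def)
  have nm: "n \<ge> 1" "m \<ge> 1" using f g eq by (auto simp: opers_def)
  have "f' = compose_op A n h' (map (\<lambda>v. compose_op A n v us) vs)"
    using us vs C by (auto simp: clone_def n_ary_def intro!: compose_op_assoc)
  moreover have "set (map (\<lambda>v. compose_op A n v us) vs) \<subseteq> n_ary C n"
    using C us vs nm by (auto simp: clone_def)
  ultimately show ?thesis
    using vs eq by (auto simp: clone_le_def intro!: exI[of _ "map (\<lambda>v. compose_op A n v us) vs"])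
qed

lemma equiv_clone_equiv:
  assumes "clone A C"
  shows "equiv (opers A) (clone_equiv A C)"
proof (rule equivI)
  show "clone_equiv A C \<subseteq> opers A \<times> opers A"
    by (auto simp: clone_equiv_def)
  show "refl_on (opers A) (clone_equiv A C)"
    using clone_le_refl[OF assms] by (auto simp: refl_on_def clone_equiv_def)
  show "sym (clone_equiv A C)"
    by (auto simp: sym_def clone_equiv_def)
  show "trans (clone_equiv A C)"
  proof (rule transI)
    fix f g h
    assume "(f, g) \<in> clone_equiv A C" "(g, h) \<in> clone_equiv A C"
    then have "f \<in> opers A" "g \<in> opers A" "h \<in> opers A"
      and "clone_le A C f g" "clone_le A C g f" "clone_le A C g h" "clone_le A C h g"
      unfolding clone_equiv_def by blast+
    then show "(f, h) \<in> clone_equiv A C"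
      unfolding clone_equiv_def using clone_le_trans[OF assms] by blast
  qed
qed

end

theory Submission
  imports Defs
begin

text \<open>
  An inequality \<open>f \<le> g\<close> modulo \<open>Pol A r \<rho>\<close> is a homomorphism between powers of the structure
  \<open>(A, \<rho>)\<close> that respects the colourings \<open>f\<close> and \<open>g\<close> of these powers. Consider a cycle
  with \<open>3 * m\<close> vertices, coloured cyclically by \<open>0, 1, 2\<close>, and \<open>r - 2\<close> further vertices with a
  colour of their own; the hyperedges consist of two consecutive vertices of the cycle and all
  the further vertices. A colour-preserving homomorphism between two such hypergraphs winds one
  cycle around the other, so it exists only if the length of the second divides that of
  the first. Since \<open>\<rho>\<close> is central, each of these hypergraphs embeds in a power of \<open>(A, \<rho>)\<close>.
  The \<open>r + 1\<close> colours of the embedded vertices and one more for the rest of the power fit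
  into \<open>A\<close> as \<open>r \<le> k - 2\<close>.
\<close>

text \<open>Total symmetry allows \<open>c\<close> to be moved to the front, where centrality
  applies.\<close>

lemma central_relation_mem_center:
  assumes \<rho>: "totally_symmetric r \<rho>"
    and c: "\<And>ys. ys \<in> tuples A (r - 1) \<Longrightarrow> c # ys \<in> \<rho>"
    and xs: "xs \<in> tuples A r" "c \<in> set xs"
  shows "xs \<in> \<rho>"
proof -
  obtain ys where eq: "mset xs = mset (c # ys)"
    using xs(2) by (metis insert_DiffM mset.simps(2) set_mset_mset ex_mset)
  have ys: "length (c # ys) = r" "set (c # ys) \<subseteq> A"
    using xs(1) mset_eq_length[OF eq] mset_eq_setD[OF eq] by (auto simp: tuples_def)
  then have "c # ys \<in> \<rho>"
    by (intro c) (auto simp: tuples_def)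
  moreover obtain p where "p permutes {..<r}" "permute_list p (c # ys) = xs"
    using mset_eq_permutation[OF eq] ys(1) by metis
  ultimately show ?thesis
    using \<rho> unfolding totally_symmetric_def by metis
qed

lemma finite_tuples: "finite A \<Longrightarrow> finite (tuples A n)"
  using finite_lists_length_eq[of A n] by (simp add: tuples_def conj_commute)

section \<open>Cycle hypergraphs and their embedding in powers\<close>

locale coloured_central =
  fixes A :: "'a set" and r :: nat and \<rho> :: "'a list set"
    and c :: 'a and a :: "'a list" and col :: "nat \<Rightarrow> 'a"
  assumes finite_A: "finite A" and r: "2 \<le> r" and c_A: "c \<in> A"
    and rel_subset: "\<rho> \<subseteq> tuples A r"
    and mem_center: "\<lbrakk>xs \<in> tuples A r; c \<in> set xs\<rbrakk> \<Longrightarrow> xs \<in> \<rho>"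
    and a: "a \<in> tuples A r" "a \<notin> \<rho>"
    and inj_col: "inj_on col {..Suc r}" and col_A: "col ` {..Suc r} \<subseteq> A"
begin

definition order :: "nat \<Rightarrow> nat" where
  "order m = 3 * m + (r - 2)"

definition edge :: "nat \<Rightarrow> nat \<Rightarrow> nat \<Rightarrow> nat list" where
  "edge m p q = [p, q] @ [3 * m..<order m]"

text \<open>Three colours orient the cycle, which the symmetric relation \<open>\<rho>\<close> alone
  cannot do.\<close>

definition colour :: "nat \<Rightarrow> nat \<Rightarrow> nat" where
  "colour m v = (if v < 3 * m then v mod 3 else 3 + (v - 3 * m))"

text \<open>The homomorphisms from the hypergraph to \<open>(A, \<rho>)\<close>, as lists of values.\<close>

definition homs :: "nat \<Rightarrow> 'a list set" where
  "homs m = {xs \<in> tuples A (order m).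
     \<forall>i<3 * m. map (nth xs) (edge m i (Suc i mod (3 * m))) \<in> \<rho>}"

text \<open>A fixed enumeration of the homomorphisms, which index the coordinates of the
  power.\<close>

definition hom_list :: "nat \<Rightarrow> 'a list list" where
  "hom_list m = (SOME L. set L = homs m)"

text \<open>Evaluation at \<open>v\<close>: the canonical map from vertices to the power.\<close>

definition point :: "nat \<Rightarrow> nat \<Rightarrow> 'a list" where
  "point m v = map (\<lambda>xs. xs ! v) (hom_list m)"

text \<open>No vertex has the colour \<open>col (Suc r)\<close>, so colour-preserving maps between
  powers send vertices to vertices.\<close>

definition colouring :: "nat \<Rightarrow> 'a list \<Rightarrow> 'a" where
  "colouring m = (\<lambda>t\<in>tuples A (length (hom_list m)).
     if t \<in> point m ` {..<order m}
     then col (colour m (inv_into {..<order m} (point m) t)) else col (Suc r))"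

definition coloured_op :: "nat \<Rightarrow> 'a oper" where
  "coloured_op m = (length (hom_list m), colouring m)"

lemma center_not_mem: "c \<notin> set a"
  using a mem_center by blast

lemma set_hom_list: "set (hom_list m) = homs m"
proof -
  have "finite (homs m)"
    unfolding homs_def using finite_tuples[OF finite_A] by simp
  then show ?thesis
    unfolding hom_list_def by (metis (mono_tags) finite_list someI_ex)
qed

text \<open>A value \<open>c\<close> at one end of each cycle edge suffices by
  \<open>mem_center\<close>, whatever the other values in \<open>A\<close> are.\<close>

lemma homsI:
  assumes "\<And>v. v < order m \<Longrightarrow> g v \<in> A"
    and "\<And>i. i < 3 * m \<Longrightarrow> g i = c \<or> g (Suc i mod (3 * m)) = c"
  shows "map g [0..<order m] \<in> homs m"
proof -
  have "map (nth (map g [0..<order m])) (edge m i (Suc i mod (3 * m))) \<in> \<rho>" if i: "i < 3 * m" for i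
  proof -
    have less: "v < order m" if "v \<in> set (edge m i (Suc i mod (3 * m)))" for v
      using that i mod_less_divisor[of "3 * m" "Suc i"]
      by (auto simp: edge_def order_def simp del: mod_less_divisor intro: trans_less_add1)
    then have eq: "map (nth (map g [0..<order m])) (edge m i (Suc i mod (3 * m)))
        = map g (edge m i (Suc i mod (3 * m)))"
      by auto
    have "map g (edge m i (Suc i mod (3 * m))) \<in> tuples A r"
      using less assms(1) r by (auto simp: tuples_def) (simp add: edge_def order_def)
    moreover have "c \<in> set (map g (edge m i (Suc i mod (3 * m))))"
      using assms(2)[OF i] by (auto simp: edge_def)
    ultimately show ?thesis
      unfolding eq by (rule mem_center)
  qed
  then show ?thesis
    using assms(1) by (auto simp: homs_def tuples_def)
qed

lemma Suc_mod_neq: "i < 3 * m \<Longrightarrow> Suc i mod (3 * m) \<noteq> i"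
  by (cases "Suc i = 3 * m") (auto intro: gr0I)

lemma Suc_mod_mod_3: "Suc i mod (3 * m) mod 3 = Suc i mod (3::nat)"
  by (simp add: mod_mod_cancel)

text \<open>The homomorphism with value \<open>a ! 0\<close> at \<open>u\<close> and
  \<open>c\<close> elsewhere separates \<open>u\<close> from all other vertices.\<close>

lemma inj_on_point: "inj_on (point m) {..<order m}"
proof (rule inj_onI)
  fix u v assume uv: "u \<in> {..<order m}" "v \<in> {..<order m}" and eq: "point m u = point m v"
  let ?g = "\<lambda>w. if w = u then a ! 0 else c"
  have a0: "a ! 0 \<in> A" "a ! 0 \<noteq> c"
    using a(1) r center_not_mem nth_mem[of 0 a] by (auto simp: tuples_def simp del: nth_mem)
  have "map ?g [0..<order m] \<in> homs m"
    using a0 c_A Suc_mod_neq by (intro homsI) auto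
  then have "map ?g [0..<order m] ! u = map ?g [0..<order m] ! v"
    using eq unfolding point_def set_hom_list[symmetric] by (meson map_eq_conv)
  then show "u = v"
    using uv a0 by (auto split: if_splits)
qed

lemma point_in_tuples: "v < order m \<Longrightarrow> point m v \<in> tuples A (length (hom_list m))"
  using set_hom_list[of m] by (auto simp: point_def tuples_def homs_def)

lemma colour_le: "v < order m \<Longrightarrow> colour m v \<le> r"
  using r mod_less_divisor[of 3 v] by (auto simp: colour_def order_def)

lemma colouring_point: "v < order m \<Longrightarrow> colouring m (point m v) = col (colour m v)"
  using point_in_tuples inj_on_point by (auto simp: colouring_def)

lemma coloured_op_in_opers: "coloured_op m \<in> opers A"
proof -
  \<comment> \<open>The constant map \<open>c\<close> is a homomorphism, so the arity is at least
    1.\<close>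
  have "map (\<lambda>_. c) [0..<order m] \<in> homs m"
    using c_A by (intro homsI) auto
  then have "hom_list m \<noteq> []"
    using set_hom_list[of m] by auto
  moreover have "col (colour m (inv_into {..<order m} (point m) t)) \<in> A"
    if "t \<in> point m ` {..<order m}" for t
    using that colour_le inv_into_into[OF that] col_A by fastforce
  ultimately show ?thesis
    using col_A by (auto simp: coloured_op_def opers_def colouring_def Suc_le_eq)
qed

lemma colouring_eq_col:
  assumes "t \<in> tuples A (length (hom_list m))" "colouring m t = col i" "i \<le> r"
  obtains v where "v < order m" "t = point m v" "colour m v = i"
proof (cases "t \<in> point m ` {..<order m}")
  case True
  then obtain v where v: "v < order m" "t = point m v" by auto
  then have "col (colour m v) = col i"
    using assms(2) colouring_point by simp
  then have "colour m v = i"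
    using inj_onD[OF inj_col] colour_le[OF v(1)] assms(3) by auto
  with v that show ?thesis by blast
next
  case False
  then have "col (Suc r) = col i"
    using assms(1,2) by (simp add: colouring_def)
  then show ?thesis
    using inj_onD[OF inj_col, of "Suc r" i] assms(3) by simp
qed

section \<open>Winding one cycle around another\<close>

text \<open>Otherwise the map that spells \<open>a\<close> along \<open>edge m p q\<close> and is
  \<open>c\<close> elsewhere would be a homomorphism, although it sends this tuple to
  \<open>a\<close>, outside \<open>\<rho>\<close>.\<close>

lemma edge_consecutive:
  assumes p: "p < 3 * m" and q: "q < 3 * m" "q mod 3 = Suc p mod 3"
    and edge: "\<And>xs. xs \<in> homs m \<Longrightarrow> map (nth xs) (edge m p q) \<in> \<rho>"
  shows "q = Suc p mod (3 * m)"
proof (rule ccontr)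
  assume neq: "q \<noteq> Suc p mod (3 * m)"
  define u where "u = edge m p q"
  define g where "g = (\<lambda>v. case map_of (zip u a) v of None \<Rightarrow> c | Some y \<Rightarrow> y)"
  have "p \<noteq> q" using q(2) by presburger
  then have u: "distinct u" "length u = length a"
    using p q(1) r a(1) by (auto simp: u_def edge_def order_def tuples_def)
  have g_A: "g v \<in> A" for v
    using a(1) c_A by (auto simp: g_def tuples_def split: option.split dest!: map_of_SomeD set_zip_rightD)
  have g_c: "g v = c" if "v \<notin> set u" for v
    using that u by (simp add: g_def map_of_zip_is_None[THEN iffD2])
  have hom: "map g [0..<order m] \<in> homs m"
  proof (rule homsI[OF g_A])
    fix i assume i: "i < 3 * m"
    \<comment> \<open>A cycle edge inside \<open>{p, q}\<close> runs from \<open>p\<close> to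
      \<open>q\<close>, against \<open>neq\<close>, or from \<open>q\<close> to \<open>p\<close>,
      against the residues mod 3.\<close>
    have "i \<notin> {p, q} \<or> Suc i mod (3 * m) \<notin> {p, q}"
    proof (rule ccontr)
      assume "\<not> ?thesis"
      then consider "i = p" "Suc i mod (3 * m) = q" | "i = q" "Suc i mod (3 * m) = p"
        using Suc_mod_neq[OF i] by auto
      then show False
      proof cases
        case 2
        then have "p mod 3 = Suc q mod 3"
          using Suc_mod_mod_3 by metis
        then show False using q(2) by presburger
      qed (use neq in simp)
    qed
    moreover have "v \<in> set u \<longleftrightarrow> v \<in> {p, q}" if "v < 3 * m" for v
      using that by (auto simp: u_def edge_def)
    ultimately show "g i = c \<or> g (Suc i mod (3 * m)) = c"
      using i mod_less_divisor[of "3 * m" "Suc i"] g_c by (metis less_nat_zero_code not_gr_zero)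
  qed
  have "v < order m" if "v \<in> set u" for v
    using that p q(1) by (auto simp: u_def edge_def order_def)
  then have "map (nth (map g [0..<order m])) u = map g u"
    by auto
  also have "\<dots> = a"
    using u by (intro nth_equalityI) (auto simp: g_def map_of_zip_nth)
  finally show False
    using edge[OF hom] a(2) by (simp add: u_def)
qed

lemma dvd_if_clone_le:
  assumes m: "m \<ge> 1" and n: "n \<ge> 1"
    and le: "clone_le A (Pol A r \<rho>) (coloured_op n) (coloured_op m)"
  shows "m dvd n"
proof -
  obtain hs where hs: "length hs = length (hom_list m)"
      "set hs \<subseteq> n_ary (Pol A r \<rho>) (length (hom_list n))"
      "colouring n = compose_op A (length (hom_list n)) (colouring m) hs"
    using le by (auto simp: clone_le_def coloured_op_def)
  \<comment> \<open>The homomorphism between the powers with components \<open>hs\<close>;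
    \<open>w\<close> below is the map it induces on vertices.\<close>
  define H where "H t = map (\<lambda>h. h t) hs" for t
  have "\<exists>w<order m. H (point n v) = point m w \<and> colour m w = colour n v"
    if v: "v < order n" for v
  proof -
    have "H (point n v) \<in> tuples A (length (hom_list m))"
      using hs point_in_tuples[OF v]
      by (fastforce simp: H_def tuples_def n_ary_def Pol_def opers_def)
    moreover have "colouring m (H (point n v)) = col (colour n v)"
      using colouring_point[OF v] point_in_tuples[OF v]
      by (simp add: hs(3) compose_op_def H_def)
    ultimately show ?thesis
      using colouring_eq_col[OF _ _ colour_le[OF v]] by metis
  qed
  then obtain w where w: "\<And>v. v < order n \<Longrightarrow> w v < order m"
      "\<And>v. v < order n \<Longrightarrow> H (point n v) = point m (w v)"
      "\<And>v. v < order n \<Longrightarrow> colour m (w v) = colour n v"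
    by metis
  \<comment> \<open>Colours below 3 occur only on the cycle.\<close>
  have cycle: "w i < 3 * m \<and> w i mod 3 = i mod 3" if "i < 3 * n" for i
    using w(3)[of i] that mod_less_divisor[of 3 i]
    by (auto simp: colour_def order_def split: if_splits)
  \<comment> \<open>Each further vertex is determined by its colour.\<close>
  have apex: "w (3 * n + j) = 3 * m + j" if "j < r - 2" for j
  proof -
    have "colour m (w (3 * n + j)) = 3 + j"
      using w(3)[of "3 * n + j"] that by (simp add: colour_def order_def)
    then show ?thesis
      using mod_less_divisor[of 3 "w (3 * n + j)"] by (simp add: colour_def split: if_splits)
  qed
  have step: "w (Suc i mod (3 * n)) = Suc (w i) mod (3 * m)" if i: "i < 3 * n" for i
  proof (rule edge_consecutive)
    define i' where "i' = Suc i mod (3 * n)"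
    have i': "i' < 3 * n" "i' mod 3 = Suc i mod 3"
      using n Suc_mod_mod_3 by (auto simp: i'_def)
    show "w i < 3 * m" "w (Suc i mod (3 * n)) < 3 * m"
      using cycle i i' by (auto simp: i'_def)
    show "w (Suc i mod (3 * n)) mod 3 = Suc (w i) mod 3"
      using cycle[OF i] cycle[OF i'(1)] i'(2) unfolding i'_def by (metis mod_Suc_eq)
    define e where "e = edge n i i'"
    have e_less: "v < order n" if "v \<in> set e" for v
      using that i i' by (auto simp: e_def edge_def order_def)
    have e_length: "length e = r"
      using r by (simp add: e_def edge_def order_def)
    have "map w [3 * n..<order n] = [3 * m..<order m]"
      using apex by (intro nth_equalityI) (auto simp: order_def)
    then have map_w: "map w e = edge m (w i) (w i')"
      by (simp add: e_def edge_def)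
    \<comment> \<open>The rows are the homomorphisms restricted to the edge \<open>e\<close>, hence
      in \<open>\<rho>\<close>; the columns are the points of the vertices of
      \<open>e\<close>.\<close>
    define ts where "ts = map (\<lambda>xs. map (nth xs) e) (hom_list n)"
    have ts: "length ts = length (hom_list n)" "set ts \<subseteq> \<rho>"
      using set_hom_list[of n] i by (auto simp: ts_def homs_def e_def i'_def)
    have col_ts: "map (\<lambda>t. t ! j) ts = point n (e ! j)" if "j < r" for j
      using that e_length by (auto simp: ts_def point_def)
    \<comment> \<open>\<open>xs\<close> is a coordinate of the target power, and the component
      \<open>hs ! l\<close> that computes it preserves \<open>\<rho>\<close>.\<close>
    fix xs assume "xs \<in> homs m"
    then obtain l where l: "l < length hs" "xs = hom_list m ! l"
      using set_hom_list[of m] hs(1) by (metis in_set_conv_nth)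
    have "hs ! l \<in> n_ary (Pol A r \<rho>) (length (hom_list n))"
      using hs(2) l by auto
    then have "map (\<lambda>j. (hs ! l) (map (\<lambda>t. t ! j) ts)) [0..<r] \<in> \<rho>"
      using ts unfolding n_ary_def Pol_def by blast
    also have "map (\<lambda>j. (hs ! l) (map (\<lambda>t. t ! j) ts)) [0..<r] = map (nth xs) (map w e)"
    proof (rule nth_equalityI)
      fix j assume "j < length (map (\<lambda>j. (hs ! l) (map (\<lambda>t. t ! j) ts)) [0..<r])"
      then have j: "j < r" by simp
      then have "(hs ! l) (point n (e ! j)) = H (point n (e ! j)) ! l"
        using l by (simp add: H_def)
      also have "\<dots> = point m (w (e ! j)) ! l"
        using w(2)[OF e_less] j e_length by simp
      also have "\<dots> = xs ! w (e ! j)"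
        using l hs(1) by (simp add: point_def)
      finally show "map (\<lambda>j. (hs ! l) (map (\<lambda>t. t ! j) ts)) [0..<r] ! j = map (nth xs) (map w e) ! j"
        using j e_length col_ts by simp
    qed (simp add: e_length)
    finally show "map (nth xs) (edge m (w i) (w (Suc i mod (3 * n)))) \<in> \<rho>"
      by (simp only: map_w i'_def)
  qed
  \<comment> \<open>By \<open>step\<close>, \<open>w\<close> advances by one each time; a full turn
    \<open>i = 3 * n\<close> must return to \<open>w 0\<close>.\<close>
  have "w (i mod (3 * n)) = (w 0 + i) mod (3 * m)" for i
  proof (induction i)
    case 0
    show ?case using cycle[of 0] n by simp
  next
    case (Suc i)
    have "w (Suc i mod (3 * n)) = Suc (w (i mod (3 * n))) mod (3 * m)"
      using step[of "i mod (3 * n)"] n by (simp add: mod_Suc_eq)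
    then show ?case by (simp add: Suc mod_Suc_eq)
  qed
  from this[of "3 * n"] this[of 0] have "(w 0 + 3 * n) mod (3 * m) = (w 0 + 0) mod (3 * m)"
    by simp
  then have "3 * m dvd 3 * n"
    by (metis add_diff_cancel_left' add.right_neutral mod_eq_dvd_iff_nat le_add1)
  then show ?thesis by simp
qed

text \<open>If \<open>coloured_op m\<close> and \<open>coloured_op n\<close> are equivalent, then
  \<open>m\<close> and \<open>n\<close> divide each other, so distinct positive \<open>m\<close>
  give distinct classes.\<close>

lemma infinite_classes: "infinite (opers A // clone_equiv A (Pol A r \<rho>))"
proof
  let ?R = "clone_equiv A (Pol A r \<rho>)"
  assume fin: "finite (opers A // ?R)"
  have "inj_on (\<lambda>m. ?R `` {coloured_op m}) {1..}"
  proof (rule inj_onI)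
    fix m n :: nat
    assume mn: "m \<in> {1..}" "n \<in> {1..}" and "?R `` {coloured_op m} = ?R `` {coloured_op n}"
    then have "(coloured_op m, coloured_op n) \<in> ?R"
      using eq_equiv_class equiv_clone_equiv[OF clone_Pol[OF rel_subset]] coloured_op_in_opers
      by metis
    then show "m = n"
      using mn by (auto simp: clone_equiv_def intro!: dvd_antisym dvd_if_clone_le)
  qed
  moreover have "(\<lambda>m. ?R `` {coloured_op m}) ` {1..} \<subseteq> opers A // ?R"
    using coloured_op_in_opers by (auto intro: quotientI)
  ultimately have "finite {1::nat..}"
    using fin by (metis inj_on_finite)
  then show False
    using infinite_Ici by blast
qed

end

theorem theorem5p3:
  fixes A :: "'a set" and k r :: nat and \<rho> :: "'a list set"
  assumes "finite A" and "card A = k" and "k \<ge> 4"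
    and "central_relation A r \<rho>"
    and "2 \<le> r" and "r \<le> k - 2"
  shows "Pol A r \<rho> \<notin> finite_class_clones A"
proof -
  obtain c where c: "c \<in> A" "\<And>ys. ys \<in> tuples A (r - 1) \<Longrightarrow> c # ys \<in> \<rho>"
    using assms(4) by (auto simp: central_relation_def)
  obtain a where a: "a \<in> tuples A r" "a \<notin> \<rho>"
    using assms(4) by (auto simp: central_relation_def)
  \<comment> \<open>There are \<open>r + 2\<close> colours, and \<open>r \<le> k - 2\<close> makes
    room for them.\<close>
  have "card {..Suc r} \<le> card A"
    using assms by simp
  then obtain col :: "nat \<Rightarrow> 'a" where col: "inj_on col {..Suc r}" "col ` {..Suc r} \<subseteq> A"
    using card_le_inj[of "{..Suc r}" A] assms(1) by auto
  have "coloured_central A r \<rho> c a col"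
    using assms c a col central_relation_mem_center[of r \<rho> A c]
    by unfold_locales (auto simp: central_relation_def)
  then show ?thesis
    using coloured_central.infinite_classes by (fastforce simp: finite_class_clones_def)
qed

end
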